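(* Let $(X,\Sigma,\mu)$ be a $\sigma$-finite measure space, let $1\le p\le\infty$ and $1\le q\le\infty$ with $\frac1p+\frac1q=1$. Let $l_A,l_B$ be positive integers, $G_A,G_B\in\Sigma$, and for $1\le i\le l_A$, $1\le j\le l_B$ let $a_i,b_j\in L_p(X,\mu)$, $c_i\in L_q(G_A,\mu)$, $e_j\in L_q(G_B,\mu)$. Let $A,B:L_p(X,\mu)\to L_p(X,\mu)$ be nonzero operators defined by $$(Ax)(t)=\int_{G_A}\sum_{i=1}^{l_A}a_i(t)c_i(s)x(s)\,d\mu_s,\qquad (Bx)(t)=\int_{G_B}\sum_{j=1}^{l_B}b_j(t)e_j(s)x(s)\,d\mu_s$$ for almost every $t$. Let $F:\mathbb{R}\to\mathbb{R}$, $F(z)=\delta z^d$, where $\delta\in\mathbb{R}$, $d\in\mathbb{Z}$, $d>0$. Let $G=G_A\cap G_B$ and $$\gamma_{i_1}=1,\qquad \gamma_{i_1,\dots,i_m}=\prod_{l=1}^{m-1}Q_{G_A}(a_{i_{l+1}},c_{i_l}),\quad m\ge2.$$ Then $AB=BF(A)$ (that is, $AB=\delta BA^d$) if and only if the following conditions are fulfilled: 1. for almost every $(t,s)\in X\times G$, $$\sum_{k=1}^{l_B}\sum_{m=1}^{l_A}a_m(t)Q_{G_A}(b_k,c_m)e_k(s)=\sum_{k=1}^{l_B}\sum_{i_1,\dots,i_d=1}^{l_A}\delta b_k(t)Q_{G_B}(e_k,a_{i_1})\gamma_{i_1,\dots,i_d}c_{i_d}(s);$$ 2. for almost every $(t,s)\in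 X\times(G_A\setminus G)$, $$\sum_{k=1}^{l_B}\sum_{i_1,\dots,i_d=1}^{l_A}\delta b_k(t)Q_{G_B}(e_k,a_{i_1})\gamma_{i_1,\dots,i_d}c_{i_d}(s)=0;$$ 3. for almost every $(t,s)\in X\times(G_B\setminus G)$, $$\sum_{k=1}^{l_B}\sum_{m=1}^{l_A}Q_{G_A}(b_k,c_m)a_m(t)e_k(s)=0.$$
   Context: $L_p(X,\mu)$ is the Banach space of (classes modulo null sets of) real-valued measurable functions on $X$ with $\int_X|f|^p\,d\mu<\infty$ ($1\le p<\infty$), or essentially bounded ($p=\infty$). For $G\in\Sigma$, $L_q(G,\mu)$ is the same with $X$ replaced by $G$. The relation $\frac1p+\frac1q=1$ uses $1/\infty=0$. The index in $\mu_s$ indicates the variable of integration. For $\Lambda\in\Sigma$ and functions $u,v$ on $\Lambda$ for which the integral exists and is finite, $Q_\Lambda(u,v)=\int_\Lambda u(t)v(t)\,d\mu$. *)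

theory Defs
  imports "HOL-Analysis.Analysis"
begin

definition Lp_fun :: "'a measure \<Rightarrow> ennreal \<Rightarrow> ('a \<Rightarrow> real) set" where
  "Lp_fun M p = {f \<in> borel_measurable M.
     if p = \<infinity> then \<exists>C. AE t in M. \<bar>f t\<bar> \<le> C
     else integrable M (\<lambda>t. \<bar>f t\<bar> powr enn2real p)}"

text \<open>An element of the Banach space \<open>L\<^sub>p\<close> is a class of functions in \<^const>\<open>Lp_fun\<close>
  modulo equality almost everywhere. A class is represented as the set of its members.\<close>

definition Lp_class :: "'a measure \<Rightarrow> ennreal \<Rightarrow> ('a \<Rightarrow> real) \<Rightarrow> ('a \<Rightarrow> real) set" where
  "Lp_class M p f = {g \<in> Lp_fun M p. AE t in M. g t = f t}"

definition Lp_space :: "'a measure \<Rightarrow> ennreal \<Rightarrow> ('a \<Rightarrow> real) set set" where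
  "Lp_space M p = Lp_class M p ` Lp_fun M p"

definition Lp_zero :: "'a measure \<Rightarrow> ennreal \<Rightarrow> ('a \<Rightarrow> real) set" where
  "Lp_zero M p = Lp_class M p (\<lambda>t. 0)"

text \<open>Scalar multiplication on classes. It is not the elementwise image of \<open>u\<close>: for
  \<open>r = 0\<close> that image is the single function \<open>0\<close> rather than its whole class.\<close>

definition Lp_scale ::
    "'a measure \<Rightarrow> ennreal \<Rightarrow> real \<Rightarrow> ('a \<Rightarrow> real) set \<Rightarrow> ('a \<Rightarrow> real) set" where
  "Lp_scale M p r u = {g \<in> Lp_fun M p. \<exists>f\<in>u. AE t in M. g t = r * f t}"

definition Q :: "'a measure \<Rightarrow> 'a set \<Rightarrow> ('a \<Rightarrow> real) \<Rightarrow> ('a \<Rightarrow> real) \<Rightarrow> real" where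
  "Q M \<Lambda> u v = (LINT t:\<Lambda>|M. u t * v t)"

text \<open>The multi-index \<open>i\<^sub>1, \<dots>, i\<^sub>m\<close> is given as a function \<open>i\<close>, used at the arguments
  \<open>1, \<dots>, m\<close> only. For \<open>m = 1\<close> the product is empty, so the value is \<open>1\<close>.\<close>

definition gamma_coeff ::
    "'a measure \<Rightarrow> 'a set \<Rightarrow> (nat \<Rightarrow> 'a \<Rightarrow> real) \<Rightarrow> (nat \<Rightarrow> 'a \<Rightarrow> real) \<Rightarrow> (nat \<Rightarrow> nat) \<Rightarrow> nat \<Rightarrow> real"
  where
  "gamma_coeff M \<Lambda> a c i m = (\<Prod>l=1..m - 1. Q M \<Lambda> (a (i (l + 1))) (c (i l)))"

end

theory Submission
  imports Defs
begin

text \<open>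
  Both sides of \<open>A B = \<delta> B A\<^sup>d\<close> are integral operators with degenerate kernels, that is, with
  kernels of the form \<open>\<Sum>\<^sub>r f\<^sub>r(t) g\<^sub>r(s)\<close>. Composing such an operator on the left with another one
  only replaces each \<open>f\<^sub>r\<close> by its image (\<open>fin_rank_comp\<close>). Hence \<open>A B\<close> has the kernel
  \<open>\<Sum>\<^sub>k (A b\<^sub>k)(t) e\<^sub>k(s)\<close>, supported in \<open>s \<in> G\<^sub>B\<close>. Iterating \<open>A\<close> produces one scalar
  \<open>Q(a\<^bsub>i\<^esub>, c\<^bsub>i'\<^esub>)\<close> for each pair of consecutive indices, which is how the products \<open>\<gamma>\<close> arise
  (\<open>fin_rank_funpow\<close>), and the kernel of \<open>\<delta> B A\<^sup>d\<close> is supported in \<open>s \<in> G\<^sub>A\<close>.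

  The commutation relation says that the difference of the two operators vanishes, and the three
  conditions say that the difference of the two kernels vanishes almost everywhere on \<open>G\<close>, on
  \<open>G\<^sub>A - G\<close> and on \<open>G\<^sub>B - G\<close>; elsewhere both kernels are zero. The theorem thus reduces
  to the fact that a degenerate kernel whose operator vanishes on \<open>L\<^sub>p\<close> is zero almost everywhere
  (\<open>fin_rank_zero_iff_kernel_zero\<close>). The exceptional null set of \<open>t\<close> depends on the argument of
  the operator, and \<open>L\<^sub>p\<close> need not be separable, so testing against all indicators is of no direct
  use. For a degenerate kernel \<open>K\<close>, however, finitely many test functions suffice on a set \<open>E\<close>
  of finite measure where all \<open>g\<^sub>r\<close> are bounded: apply the operator to \<open>1\<^sub>E g\<^sub>r\<close>,
  multiply by \<open>f\<^sub>r(t)\<close> and sum over \<open>r\<close>; the result is \<open>\<integral>\<^sub>E K(t,s)\<^sup>2 ds = 0\<close>. Countably many sets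
  \<open>E\<close> cover the space.
\<close>

section \<open>Duality between the exponents\<close>

lemma conj_exponents_cases:
  fixes p q :: ennreal
  assumes "1 \<le> p" "1 \<le> q" "1 / p + 1 / q = 1"
  obtains (left_inf) "p = \<infinity>" "q = 1"
    | (right_inf) "p = 1" "q = \<infinity>"
    | (finite) P R where "p = ennreal P" "q = ennreal R" "1 < P" "1 < R" "1 / P + 1 / R = 1"
proof -
  have top: "y = 1" if "1 / x + 1 / y = 1" "x = top" "1 \<le> y" for x y :: ennreal
  proof (cases y)
    case (real r)
    with that have r: "1 \<le> r" by (simp flip: ennreal_1)
    have "1 / y = ennreal (1 / r)"
      using real r by (simp add: divide_ennreal flip: ennreal_1)
    with that have "ennreal (1 / r) = ennreal 1" by simp
    with r have "r = 1" by (subst (asm) ennreal_inj) auto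
    with real show ?thesis by simp
  next
    case top
    with that show ?thesis by simp
  qed
  consider "p = top" | "q = top" | P R where "p = ennreal P" "0 \<le> P" "q = ennreal R" "0 \<le> R"
    by (cases p; cases q) auto
  then show thesis
  proof cases
    case 1
    with top[of p q] assms left_inf show ?thesis by (simp add: infinity_ennreal_def)
  next
    case 2
    with top[of q p] assms right_inf show ?thesis by (simp add: infinity_ennreal_def add.commute)
  next
    case (3 P R)
    with assms have PR: "1 \<le> P" "1 \<le> R" by (simp_all flip: ennreal_1)
    have "1 / p = ennreal (1 / P)" "1 / q = ennreal (1 / R)"
      using 3 PR by (simp_all add: divide_ennreal flip: ennreal_1)
    with assms PR have "ennreal (1 / P + 1 / R) = ennreal 1"
      by (simp add: ennreal_plus)
    with PR have sum1: "1 / P + 1 / R = 1"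
      by (subst (asm) ennreal_inj) auto
    have "P \<noteq> 1" "R \<noteq> 1" using sum1 PR by auto
    with PR sum1 3 finite show ?thesis by auto
  qed
qed

lemma Lp_fun_measurable: "f \<in> Lp_fun M p \<Longrightarrow> f \<in> borel_measurable M"
  by (simp add: Lp_fun_def)

lemma Lp_fun_top_bound:
  assumes "f \<in> Lp_fun M p" "p = \<infinity>"
  obtains C where "AE t in M. \<bar>f t\<bar> \<le> C"
  using assms by (auto simp: Lp_fun_def)

lemma Lp_fun_1_integrable: "f \<in> Lp_fun M 1 \<Longrightarrow> integrable M f"
  by (simp add: Lp_fun_def) (metis integrable_abs_cancel)

lemma Lp_fun_finite_integrable:
  "f \<in> Lp_fun M (ennreal P) \<Longrightarrow> 0 \<le> P \<Longrightarrow> integrable M (\<lambda>t. \<bar>f t\<bar> powr P)"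
  by (simp add: Lp_fun_def)

lemma integrable_mult_AE_bounded:
  fixes f g :: "'a \<Rightarrow> real"
  assumes "integrable M f" "g \<in> borel_measurable M" "AE t in M. \<bar>g t\<bar> \<le> C"
  shows "integrable M (\<lambda>t. f t * g t)"
proof (rule Bochner_Integration.integrable_bound)
  show "integrable M (\<lambda>t. C * f t)" using assms by simp
  show "(\<lambda>t. f t * g t) \<in> borel_measurable M"
    using assms by (intro borel_measurable_times) auto
  show "AE t in M. norm (f t * g t) \<le> norm (C * f t)"
    using assms(3)
  proof eventually_elim
    case (elim t)
    then have "\<bar>g t\<bar> * \<bar>f t\<bar> \<le> \<bar>C\<bar> * \<bar>f t\<bar>" by (intro mult_right_mono) auto
    then show ?case by (simp add: abs_mult mult.commute)
  qed
qed

text \<open>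
  Only integrability of the product is used later, so the pointwise Young inequality replaces
  the Hoelder norm estimate.
\<close>

lemma Lp_Lq_integrable_mult:
  assumes "1 \<le> p" "1 \<le> q" "1 / p + 1 / q = 1"
    and f: "f \<in> Lp_fun M p" and g: "g \<in> Lp_fun M q"
  shows "integrable M (\<lambda>t. f t * g t)"
  using assms(1-3)
proof (cases rule: conj_exponents_cases)
  case left_inf
  from left_inf(1) obtain C where "AE t in M. \<bar>f t\<bar> \<le> C" by (rule Lp_fun_top_bound[OF f])
  then have "integrable M (\<lambda>t. g t * f t)"
    using f g left_inf
    by (intro integrable_mult_AE_bounded Lp_fun_1_integrable) (auto dest: Lp_fun_measurable)
  then show ?thesis by (simp add: mult.commute)
next
  case right_inf
  from right_inf(2) obtain C where "AE t in M. \<bar>g t\<bar> \<le> C" by (rule Lp_fun_top_bound[OF g])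
  then show ?thesis
    using f g right_inf
    by (intro integrable_mult_AE_bounded Lp_fun_1_integrable) (auto dest: Lp_fun_measurable)
next
  case (finite P R)
  show ?thesis
  proof (rule Bochner_Integration.integrable_bound)
    show "integrable M (\<lambda>t. \<bar>f t\<bar> powr P / P + \<bar>g t\<bar> powr R / R)"
      using f g finite
      by (intro Bochner_Integration.integrable_add integrable_divide Lp_fun_finite_integrable) auto
    show "(\<lambda>t. f t * g t) \<in> borel_measurable M"
      using f g by (intro borel_measurable_times Lp_fun_measurable)
    show "AE t in M. norm (f t * g t) \<le> norm (\<bar>f t\<bar> powr P / P + \<bar>g t\<bar> powr R / R)"
    proof (rule AE_I2)
      fix t
      have "\<bar>f t\<bar> * \<bar>g t\<bar> \<le> \<bar>f t\<bar> powr P / P + \<bar>g t\<bar> powr R / R"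
        using finite by (intro Youngs_inequality) auto
      then show "norm (f t * g t) \<le> norm (\<bar>f t\<bar> powr P / P + \<bar>g t\<bar> powr R / R)"
        by (simp add: abs_mult)
    qed
  qed
qed

text \<open>This supplies test functions lying in \<open>L\<^sub>p\<close> for every exponent at once.\<close>

lemma bounded_finite_support_in_Lp_fun:
  assumes p: "1 \<le> p" and E: "E \<in> sets M" "emeasure M E < \<infinity>"
    and x: "x \<in> borel_measurable M" "\<And>s. \<bar>x s\<bar> \<le> C" "\<And>s. s \<notin> E \<Longrightarrow> x s = 0"
  shows "x \<in> Lp_fun M p"
proof (cases "p = \<infinity>")
  case True
  then show ?thesis using x by (auto simp: Lp_fun_def)
next
  case False
  define P where "P = enn2real p"
  have "P \<ge> 0" by (simp add: P_def)
  have "integrable M (\<lambda>t. \<bar>x t\<bar> powr P)"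
  proof (rule Bochner_Integration.integrable_bound)
    show "integrable M (\<lambda>t. C powr P * indicator E t)"
      using E by (intro integrable_mult_right integrable_real_indicator)
    show "(\<lambda>t. \<bar>x t\<bar> powr P) \<in> borel_measurable M" using x(1) by measurable
    show "AE t in M. norm (\<bar>x t\<bar> powr P) \<le> norm (C powr P * indicator E t)"
      using x(2,3) \<open>P \<ge> 0\<close> by (intro AE_I2) (auto simp: indicator_def intro: powr_mono2)
  qed
  then show ?thesis using False x by (simp add: Lp_fun_def P_def)
qed

lemma Lp_fun_scale:
  assumes "f \<in> Lp_fun M p"
  shows "(\<lambda>t. r * f t) \<in> Lp_fun M p"
proof (cases "p = \<infinity>")
  case True
  then obtain C where C: "AE t in M. \<bar>f t\<bar> \<le> C"
    by (rule Lp_fun_top_bound[OF assms(1)])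
  have "AE t in M. \<bar>r * f t\<bar> \<le> \<bar>r\<bar> * C"
    using C by eventually_elim (auto simp: abs_mult intro: mult_left_mono)
  then show ?thesis using True assms by (auto simp: Lp_fun_def)
next
  case False
  then show ?thesis using assms
    by (auto simp: Lp_fun_def abs_mult powr_mult intro!: integrable_mult_right)
qed

lemma Lp_fun_cong_AE:
  assumes "g \<in> Lp_fun M p" "f \<in> borel_measurable M" and eq: "AE t in M. g t = f t"
  shows "f \<in> Lp_fun M p"
proof (cases "p = \<infinity>")
  case True
  then obtain C where "AE t in M. \<bar>g t\<bar> \<le> C"
    by (rule Lp_fun_top_bound[OF assms(1)])
  then have "AE t in M. \<bar>f t\<bar> \<le> C" using eq by eventually_elim auto
  then show ?thesis using True assms by (auto simp: Lp_fun_def)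
next
  case False
  have "integrable M (\<lambda>t. \<bar>g t\<bar> powr enn2real p) \<longleftrightarrow> integrable M (\<lambda>t. \<bar>f t\<bar> powr enn2real p)"
  proof (rule integrable_cong_AE)
    show "AE t in M. \<bar>g t\<bar> powr enn2real p = \<bar>f t\<bar> powr enn2real p"
      using eq by eventually_elim auto
  qed (use assms(1,2) in \<open>auto simp: Lp_fun_def\<close>)
  then show ?thesis using False assms by (auto simp: Lp_fun_def)
qed

text \<open>
  The functions \<open>c\<^sub>i\<close> and \<open>e\<^sub>j\<close> are controlled only on \<open>G\<^sub>A\<close> and \<open>G\<^sub>B\<close>, where they
  are measurable. Extending them by zero turns every integral below into one over the whole
  space, so that kernels with different domains can be subtracted.
\<close>

definition zero_ext :: "'a set \<Rightarrow> ('a \<Rightarrow> real) \<Rightarrow> 'a \<Rightarrow> real" where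
  "zero_ext \<Lambda> v s = indicator \<Lambda> s * v s"

lemma Q_zero_ext: "Q M \<Lambda> u v = (LINT s|M. u s * zero_ext \<Lambda> v s)"
  by (simp add: Q_def set_lebesgue_integral_def zero_ext_def mult.left_commute)

lemma zero_ext_in_Lp_fun:
  assumes \<Lambda>: "\<Lambda> \<in> sets M" and v: "v \<in> Lp_fun (restrict_space M \<Lambda>) q"
  shows "zero_ext \<Lambda> v \<in> Lp_fun M q"
proof -
  have \<Lambda>': "\<Lambda> \<inter> space M \<in> sets M" using \<Lambda> by simp
  have meas: "zero_ext \<Lambda> v \<in> borel_measurable M"
    using v borel_measurable_restrict_space_iff[OF \<Lambda>', of v]
    by (simp add: Lp_fun_def zero_ext_def[abs_def])
  show ?thesis
  proof (cases "q = \<infinity>")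
    case True
    then obtain C where "AE t in restrict_space M \<Lambda>. \<bar>v t\<bar> \<le> C"
      by (rule Lp_fun_top_bound[OF v])
    then have "AE t in M. t \<in> \<Lambda> \<longrightarrow> \<bar>v t\<bar> \<le> C"
      by (subst (asm) AE_restrict_space_iff[OF \<Lambda>']) auto
    then have "AE t in M. \<bar>zero_ext \<Lambda> v t\<bar> \<le> \<bar>C\<bar>"
      by eventually_elim (auto simp: zero_ext_def indicator_def)
    with True meas show ?thesis by (auto simp: Lp_fun_def)
  next
    case False
    then have "integrable M (\<lambda>t. indicator \<Lambda> t *\<^sub>R \<bar>v t\<bar> powr enn2real q)"
      using v integrable_restrict_space[OF \<Lambda>', of "\<lambda>t. \<bar>v t\<bar> powr enn2real q"]
      by (auto simp: Lp_fun_def)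
    moreover have "indicator \<Lambda> t *\<^sub>R \<bar>v t\<bar> powr enn2real q = \<bar>zero_ext \<Lambda> v t\<bar> powr enn2real q" for t
      by (simp add: zero_ext_def indicator_def)
    ultimately show ?thesis using False meas by (auto simp: Lp_fun_def)
  qed
qed

section \<open>Integral operators with degenerate kernels\<close>

text \<open>
  The index type is arbitrary because three kinds of indices occur: numbers, multi-indices, and
  the disjoint sum of both for the difference of two operators. The scalars are integrals of
  \<open>x\<close> against each \<open>g\<^sub>r\<close> separately, which makes the operator visibly finite-rank.
\<close>

definition fin_rank ::
    "'a measure \<Rightarrow> 'r set \<Rightarrow> ('r \<Rightarrow> 'a \<Rightarrow> real) \<Rightarrow> ('r \<Rightarrow> 'a \<Rightarrow> real) \<Rightarrow> ('a \<Rightarrow> real) \<Rightarrow> 'a \<Rightarrow> real"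
  where "fin_rank M I f g x t = (\<Sum>r\<in>I. f r t * (LINT s|M. x s * g r s))"

lemma integral_fin_rank_mult:
  assumes "\<And>r. r \<in> I \<Longrightarrow> integrable M (\<lambda>s. f r s * h s)"
  shows "(LINT s|M. fin_rank M I f g x s * h s) =
    (\<Sum>r\<in>I. (LINT s|M. f r s * h s) * (LINT s|M. x s * g r s))"
proof -
  have "(LINT s|M. fin_rank M I f g x s * h s) =
      (LINT s|M. (\<Sum>r\<in>I. (LINT s|M. x s * g r s) * (f r s * h s)))"
    by (simp add: fin_rank_def sum_distrib_right sum_distrib_left mult_ac)
  also have "\<dots> = (\<Sum>r\<in>I. (LINT s|M. x s * g r s) * (LINT s|M. f r s * h s))"
    using assms by (subst Bochner_Integration.integral_sum) auto
  finally show ?thesis by (simp add: mult.commute)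
qed

text \<open>
  With \<open>K\<close> the kernel and \<open>x\<^sub>r = 1\<^sub>E g\<^sub>r\<close>, bilinearity gives
  \<open>\<Sum>\<^sub>r f\<^sub>r(t) (T x\<^sub>r)(t) = \<integral>\<^sub>E K(t,s)\<^sup>2 ds\<close>. The left side vanishes outside a finite union of
  null sets, and a nonnegative function with zero integral is zero almost everywhere.
\<close>

lemma fin_rank_test_kernel_zero:
  assumes fin: "finite I"
    and int: "\<And>r r'. r \<in> I \<Longrightarrow> r' \<in> I \<Longrightarrow> integrable M (\<lambda>s. indicator E s * g r s * g r' s)"
    and zero: "\<And>r. r \<in> I \<Longrightarrow> AE t in M. fin_rank M I f g (\<lambda>s. indicator E s * g r s) t = 0"
  shows "AE t in M. AE s in M. s \<in> E \<longrightarrow> (\<Sum>r\<in>I. f r t * g r s) = 0"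
proof -
  have "AE t in M. \<forall>r\<in>I. fin_rank M I f g (\<lambda>s. indicator E s * g r s) t = 0"
    using fin zero by (intro AE_finite_allI) auto
  then show ?thesis
  proof eventually_elim
    case (elim t)
    define K where "K s = (\<Sum>r\<in>I. f r t * g r s)" for s
    have sq: "indicator E s * (K s)\<^sup>2 =
        (\<Sum>r\<in>I. \<Sum>r'\<in>I. f r t * (f r' t * (indicator E s * g r s * g r' s)))" for s
      by (simp add: K_def power2_eq_square sum_product sum_distrib_left mult_ac)
    have int2: "integrable M (\<lambda>s. indicator E s * (K s)\<^sup>2)"
      unfolding sq using int
      by (intro Bochner_Integration.integrable_sum integrable_mult_right) auto
    have "(LINT s|M. indicator E s * (K s)\<^sup>2) =
        (\<Sum>r\<in>I. f r t * fin_rank M I f g (\<lambda>s. indicator E s * g r s) t)"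
      unfolding sq using int
      by (simp add: Bochner_Integration.integral_sum fin_rank_def sum_distrib_left)
    also have "\<dots> = 0" using elim by simp
    finally have "AE s in M. indicator E s * (K s)\<^sup>2 = 0"
      by (subst (asm) integral_nonneg_eq_0_iff_AE[OF int2]) auto
    then show ?case
      by eventually_elim (auto simp: K_def)
  qed
qed

text \<open>
  Fubini's theorem for null sets gives the backward direction. For the forward one, the square
  argument above applies on each member of a countable cover of the space by sets of finite
  measure on which all \<open>g\<^sub>r\<close> are bounded.
\<close>

lemma fin_rank_zero_iff_kernel_zero:
  fixes p q :: ennreal
  assumes sf: "sigma_finite_measure M"
    and pq: "1 \<le> p" "1 \<le> q" "1 / p + 1 / q = 1"
    and fin: "finite I"
    and f: "\<And>r. r \<in> I \<Longrightarrow> f r \<in> borel_measurable M"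
    and g: "\<And>r. r \<in> I \<Longrightarrow> g r \<in> Lp_fun M q"
  shows "(\<forall>x\<in>Lp_fun M p. AE t in M. fin_rank M I f g x t = 0) \<longleftrightarrow>
    (AE (t, s) in M \<Otimes>\<^sub>M M. (\<Sum>r\<in>I. f r t * g r s) = 0)"
proof -
  interpret sigma_finite_measure M by (fact sf)
  interpret P: pair_sigma_finite M M ..
  have [measurable]: "g r \<in> borel_measurable M" if "r \<in> I" for r
    using g[OF that] by (rule Lp_fun_measurable)
  note [measurable] = f
  show ?thesis
  proof
    assume *: "AE (t, s) in M \<Otimes>\<^sub>M M. (\<Sum>r\<in>I. f r t * g r s) = 0"
    show "\<forall>x\<in>Lp_fun M p. AE t in M. fin_rank M I f g x t = 0"
    proof
      fix x assume x: "x \<in> Lp_fun M p"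
      have int: "integrable M (\<lambda>s. x s * g r s)" if "r \<in> I" for r
        using pq x g[OF that] by (rule Lp_Lq_integrable_mult)
      from P.AE_pair[OF *] show "AE t in M. fin_rank M I f g x t = 0"
      proof eventually_elim
        case (elim t)
        have "fin_rank M I f g x t = (LINT s|M. (\<Sum>r\<in>I. f r t * (x s * g r s)))"
          using int by (simp add: fin_rank_def Bochner_Integration.integral_sum)
        also have "\<dots> = 0"
        proof (rule integral_eq_zero_AE)
          from elim show "AE s in M. (\<Sum>r\<in>I. f r t * (x s * g r s)) = 0"
          proof eventually_elim
            case (elim s)
            have "(\<Sum>r\<in>I. f r t * (x s * g r s)) = x s * (\<Sum>r\<in>I. f r t * g r s)"
              by (simp add: sum_distrib_left mult_ac)
            then show ?case using elim by simp
          qed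
        qed
        finally show ?case .
      qed
    qed
  next
    assume zero: "\<forall>x\<in>Lp_fun M p. AE t in M. fin_rank M I f g x t = 0"
    obtain S :: "nat \<Rightarrow> 'a set" where S: "range S \<subseteq> sets M" "(\<Union>n. S n) = space M"
        "\<And>n. emeasure M (S n) \<noteq> \<infinity>"
      using sigma_finite by metis
    have [measurable]: "S n \<in> sets M" for n using S(1) by auto
    \<comment> \<open>The bound \<open>k\<close> makes the test functions \<open>1\<^sub>E g\<^sub>r\<close> bounded, hence members of \<open>L\<^sub>p\<close>.\<close>
    define E where "E n k = {s \<in> space M. s \<in> S n \<and> (\<Sum>r\<in>I. \<bar>g r s\<bar>) \<le> real k}" for n k
    have E [measurable]: "E n k \<in> sets M" for n k unfolding E_def by measurable
    have E_fin: "emeasure M (E n k) < \<infinity>" for n k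
    proof -
      have "emeasure M (E n k) \<le> emeasure M (S n)"
        by (intro emeasure_mono) (auto simp: E_def)
      with S(3)[of n] show ?thesis by (simp add: less_top le_less_trans)
    qed
    have test: "(\<lambda>s. indicator (E n k) s * g r s) \<in> Lp_fun M p" if r: "r \<in> I" for n k r
    proof (rule bounded_finite_support_in_Lp_fun[OF pq(1) E[of n k] E_fin[of n k]])
      show "(\<lambda>s. indicator (E n k) s * g r s) \<in> borel_measurable M" using r by measurable
      show "\<bar>indicator (E n k) s * g r s\<bar> \<le> real k" for s
      proof (cases "s \<in> E n k")
        case True
        have "\<bar>g r s\<bar> \<le> (\<Sum>r\<in>I. \<bar>g r s\<bar>)" using fin r by (intro member_le_sum) auto
        with True show ?thesis by (simp add: E_def)
      qed simp
    qed simp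
    have "AE t in M. AE s in M. s \<in> E n k \<longrightarrow> (\<Sum>r\<in>I. f r t * g r s) = 0" for n k
      using fin zero test pq g
      by (intro fin_rank_test_kernel_zero) (auto intro: Lp_Lq_integrable_mult)
    then have "AE t in M. \<forall>n k. AE s in M. s \<in> E n k \<longrightarrow> (\<Sum>r\<in>I. f r t * g r s) = 0"
      by (simp add: AE_all_countable)
    then have "AE t in M. AE s in M. (\<Sum>r\<in>I. f r t * g r s) = 0"
    proof eventually_elim
      case (elim t)
      then have "AE s in M. \<forall>n k. s \<in> E n k \<longrightarrow> (\<Sum>r\<in>I. f r t * g r s) = 0"
        by (simp only: AE_all_countable simp_thms)
      then show ?case
        using AE_space
      proof eventually_elim
        case (elim s)
        obtain n where "s \<in> S n" using elim(2) S(2) by auto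
        moreover obtain k where "(\<Sum>r\<in>I. \<bar>g r s\<bar>) \<le> real k" using real_arch_simple by blast
        ultimately have "s \<in> E n k" using elim(2) by (simp add: E_def)
        with elim(1) show ?case by blast
      qed
    qed
    then show "AE (t, s) in M \<Otimes>\<^sub>M M. (\<Sum>r\<in>I. f r t * g r s) = 0"
      by (intro P.AE_pair_measure) auto
  qed
qed

lemma fin_rank_comp:
  assumes "\<And>r k. r \<in> I \<Longrightarrow> k \<in> J \<Longrightarrow> integrable M (\<lambda>s. f' k s * g r s)"
  shows "fin_rank M I f g (fin_rank M J f' g' x) = fin_rank M J (\<lambda>k. fin_rank M I f g (f' k)) g' x"
proof
  fix t
  have "fin_rank M I f g (fin_rank M J f' g' x) t =
      (\<Sum>r\<in>I. \<Sum>k\<in>J. f r t * ((LINT s|M. f' k s * g r s) * (LINT s|M. x s * g' k s)))"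
    using assms by (simp add: fin_rank_def[of M I] integral_fin_rank_mult sum_distrib_left)
  also have "\<dots> = fin_rank M J (\<lambda>k. fin_rank M I f g (f' k)) g' x t"
    by (subst sum.swap) (simp add: fin_rank_def sum_distrib_right mult.assoc)
  finally show "fin_rank M I f g (fin_rank M J f' g' x) t =
    fin_rank M J (\<lambda>k. fin_rank M I f g (f' k)) g' x t" .
qed

lemma fin_rank_diff:
  assumes "finite I" "finite J"
  shows "fin_rank M (I <+> J) (case_sum f (\<lambda>j t. - f' j t)) (case_sum g g') x t =
    fin_rank M I f g x t - fin_rank M J f' g' x t"
  using assms by (simp add: fin_rank_def sum.Plus sum_negf)

text \<open>Summing over multi-indices one entry at a time; this drives the recursion for powers.\<close>

lemma sum_PiE_insert:
  assumes "x \<notin> S"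
  shows "(\<Sum>i\<in>Pi\<^sub>E (insert x S) T. h i) = (\<Sum>j\<in>T x. \<Sum>i\<in>Pi\<^sub>E S T. h (i(x := j)))"
  using inj_combinator[OF assms, of T]
  by (simp add: PiE_insert_eq sum.reindex sum.cartesian_product case_prod_unfold)

lemma gamma_coeff_1: "gamma_coeff M \<Lambda> a c i 1 = 1"
  by (simp add: gamma_coeff_def)

lemma gamma_coeff_Suc:
  assumes "0 < n"
  shows "gamma_coeff M \<Lambda> a c (i(Suc n := j)) (Suc n) =
    gamma_coeff M \<Lambda> a c i n * Q M \<Lambda> (a j) (c (i n))"
proof -
  obtain m where n: "n = Suc m" using assms gr0_implies_Suc by blast
  have "(\<Prod>l=1..m. Q M \<Lambda> (a ((i(Suc n := j)) (l + 1))) (c ((i(Suc n := j)) l))) =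
      (\<Prod>l=1..m. Q M \<Lambda> (a (i (l + 1))) (c (i l)))"
    using n by (intro prod.cong) auto
  then show ?thesis
    unfolding gamma_coeff_def using n by (simp add: prod.nat_ivl_Suc')
qed

text \<open>
  The induction peels off the operator applied first, \<open>S\<^bsup>n+1\<^esup> x = S\<^sup>n (S x)\<close>: its index \<open>j\<close>
  is appended at the end of the multi-index, contributing the factor \<open>Q(a\<^sub>j, c\<^bsub>i(n)\<^esub>)\<close> to \<open>\<gamma>\<close>
  while the leading function \<open>a\<^bsub>i(1)\<^esub>\<close> stays in place. Peeling from the other side would shift
  all indices.
\<close>

lemma fin_rank_funpow:
  assumes n: "0 < n"
    and int: "\<And>i j. i \<in> I \<Longrightarrow> j \<in> I \<Longrightarrow> integrable M (\<lambda>s. a i s * zero_ext \<Lambda> (c j) s)"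
  shows "(fin_rank M I a (\<lambda>i. zero_ext \<Lambda> (c i)) ^^ n) x =
    fin_rank M ({1..n} \<rightarrow>\<^sub>E I) (\<lambda>i t. gamma_coeff M \<Lambda> a c i n * a (i 1) t)
      (\<lambda>i. zero_ext \<Lambda> (c (i n))) x"
  using n
proof (induction n arbitrary: x rule: nat_induct_non_zero)
  case 1
  have "{1..1::nat} \<rightarrow>\<^sub>E I = Pi\<^sub>E (insert 1 {}) (\<lambda>_. I)" by simp
  then show ?case
    by (intro ext) (simp add: fin_rank_def sum_PiE_insert gamma_coeff_1[simplified])
next
  case (Suc n)
  let ?S = "fin_rank M I a (\<lambda>i. zero_ext \<Lambda> (c i))"
  let ?f = "\<lambda>i t. gamma_coeff M \<Lambda> a c i n * a (i 1) t"
  let ?g = "\<lambda>i::nat \<Rightarrow> _. zero_ext \<Lambda> (c (i n))"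
  let ?P = "{1..n} \<rightarrow>\<^sub>E I"
  have "(?S ^^ Suc n) x = (?S ^^ n) (?S x)" by (simp only: funpow_Suc_right o_apply)
  also have "\<dots> = fin_rank M ?P ?f ?g (?S x)" by (rule Suc.IH)
  also have "\<dots> = fin_rank M I (\<lambda>j. fin_rank M ?P ?f ?g (a j)) (\<lambda>i. zero_ext \<Lambda> (c i)) x"
    using int Suc.hyps by (intro fin_rank_comp) (auto simp: PiE_iff)
  also have "\<dots> = fin_rank M ({1..Suc n} \<rightarrow>\<^sub>E I)
      (\<lambda>i t. gamma_coeff M \<Lambda> a c i (Suc n) * a (i 1) t) (\<lambda>i. zero_ext \<Lambda> (c (i (Suc n)))) x"
  proof
    fix t
    have set: "{1..Suc n} \<rightarrow>\<^sub>E I = Pi\<^sub>E (insert (Suc n) {1..n}) (\<lambda>_. I)"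
      by (simp add: atLeastAtMostSuc_conv)
    show "fin_rank M I (\<lambda>j. fin_rank M ?P ?f ?g (a j)) (\<lambda>i. zero_ext \<Lambda> (c i)) x t =
        fin_rank M ({1..Suc n} \<rightarrow>\<^sub>E I)
          (\<lambda>i t. gamma_coeff M \<Lambda> a c i (Suc n) * a (i 1) t) (\<lambda>i. zero_ext \<Lambda> (c (i (Suc n)))) x t"
      unfolding fin_rank_def set using Suc.hyps
      by (subst sum_PiE_insert)
        (auto simp: gamma_coeff_Suc Q_zero_ext sum_distrib_left sum_distrib_right mult_ac intro!: sum.cong)
  qed
  finally show ?case .
qed

section \<open>Operators on classes\<close>

lemma Lp_class_eq_iff:
  assumes "f \<in> Lp_fun M p" "g \<in> Lp_fun M p"
  shows "Lp_class M p f = Lp_class M p g \<longleftrightarrow> (AE t in M. f t = g t)"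
proof
  assume "Lp_class M p f = Lp_class M p g"
  moreover have "f \<in> Lp_class M p f" using assms by (simp add: Lp_class_def)
  ultimately show "AE t in M. f t = g t" by (simp add: Lp_class_def)
next
  assume fg: "AE t in M. f t = g t"
  have "(AE t in M. h t = f t) \<longleftrightarrow> (AE t in M. h t = g t)" for h
    using fg by (intro eventually_subst) (auto elim: eventually_mono)
  then show "Lp_class M p f = Lp_class M p g" by (simp add: Lp_class_def)
qed

lemma Lp_scale_class:
  assumes "f \<in> Lp_fun M p"
  shows "Lp_scale M p r (Lp_class M p f) = Lp_class M p (\<lambda>t. r * f t)"
proof -
  have "(\<exists>h\<in>Lp_class M p f. AE t in M. g t = r * h t) \<longleftrightarrow> (AE t in M. g t = r * f t)" for g
  proof
    assume "\<exists>h\<in>Lp_class M p f. AE t in M. g t = r * h t"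
    then obtain h where "AE t in M. h t = f t" "AE t in M. g t = r * h t"
      by (auto simp: Lp_class_def)
    then show "AE t in M. g t = r * f t" by eventually_elim simp
  next
    assume "AE t in M. g t = r * f t"
    moreover have "f \<in> Lp_class M p f" using assms by (simp add: Lp_class_def)
    ultimately show "\<exists>h\<in>Lp_class M p f. AE t in M. g t = r * h t" by blast
  qed
  then show ?thesis by (simp add: Lp_scale_def Lp_class_def)
qed

text \<open>
  Equality of classes becomes almost-everywhere equality of functions once an operator on classes
  is replaced by a concrete operator on representatives.
\<close>

definition induces ::
    "'a measure \<Rightarrow> ennreal \<Rightarrow> (('a \<Rightarrow> real) set \<Rightarrow> ('a \<Rightarrow> real) set) \<Rightarrow>
     (('a \<Rightarrow> real) \<Rightarrow> 'a \<Rightarrow> real) \<Rightarrow> bool"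
  where "induces M p T S \<longleftrightarrow>
    (\<forall>x\<in>Lp_fun M p. S x \<in> Lp_fun M p \<and> T (Lp_class M p x) = Lp_class M p (S x))"

lemma inducesD:
  assumes "induces M p T S" "x \<in> Lp_fun M p"
  shows "S x \<in> Lp_fun M p" "T (Lp_class M p x) = Lp_class M p (S x)"
  using assms by (auto simp: induces_def)

lemma induces_funpow:
  assumes "induces M p T S"
  shows "induces M p (T ^^ n) (S ^^ n)"
proof (induction n)
  case 0
  show ?case by (simp add: induces_def)
next
  case (Suc n)
  then show ?case using assms by (simp add: induces_def)
qed

text \<open>
  The hypothesis on \<open>T\<close> constrains only the members of \<open>T [x]\<close>. Since \<open>T [x]\<close> is the class of
  some \<open>y\<close> in \<open>L\<^sub>p\<close>, it has such a member, and the integral expression inherits membership in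
  \<open>L\<^sub>p\<close> from \<open>y\<close>.
\<close>

lemma induces_fin_rank:
  assumes pq: "1 \<le> p" "1 \<le> q" "1 / p + 1 / q = 1"
    and \<Lambda>: "\<Lambda> \<in> sets M"
    and a: "\<And>i. i \<in> I \<Longrightarrow> a i \<in> borel_measurable M"
    and c: "\<And>i. i \<in> I \<Longrightarrow> c i \<in> Lp_fun (restrict_space M \<Lambda>) q"
    and T: "T \<in> Lp_space M p \<rightarrow> Lp_space M p"
    and T_eq: "\<And>x y. x \<in> Lp_fun M p \<Longrightarrow> y \<in> T (Lp_class M p x) \<Longrightarrow>
           AE t in M. y t = (LINT s:\<Lambda>|M. (\<Sum>i\<in>I. a i t * c i s * x s))"
  shows "induces M p T (fin_rank M I a (\<lambda>i. zero_ext \<Lambda> (c i)))"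
  unfolding induces_def
proof (intro ballI)
  fix x assume x: "x \<in> Lp_fun M p"
  let ?S = "fin_rank M I a (\<lambda>i. zero_ext \<Lambda> (c i))"
  have int: "integrable M (\<lambda>s. x s * zero_ext \<Lambda> (c i) s)" if "i \<in> I" for i
    using pq x zero_ext_in_Lp_fun[OF \<Lambda> c[OF that]] by (rule Lp_Lq_integrable_mult)
  have S: "(LINT s:\<Lambda>|M. (\<Sum>i\<in>I. a i t * c i s * x s)) = ?S x t" for t
  proof -
    have "(LINT s:\<Lambda>|M. (\<Sum>i\<in>I. a i t * c i s * x s)) =
        (LINT s|M. (\<Sum>i\<in>I. a i t * (x s * zero_ext \<Lambda> (c i) s)))"
      by (simp add: set_lebesgue_integral_def zero_ext_def sum_distrib_left mult_ac)
    also have "\<dots> = ?S x t"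
      using int by (simp add: fin_rank_def Bochner_Integration.integral_sum)
    finally show ?thesis .
  qed
  have "T (Lp_class M p x) \<in> Lp_space M p" using T x by (auto simp: Lp_space_def)
  then obtain y where y: "y \<in> Lp_fun M p" "T (Lp_class M p x) = Lp_class M p y"
    by (auto simp: Lp_space_def)
  then have "y \<in> T (Lp_class M p x)" by (simp add: Lp_class_def)
  then have ae: "AE t in M. y t = ?S x t" using T_eq[OF x] S by simp
  have "?S x \<in> borel_measurable M"
    unfolding fin_rank_def[abs_def] using a by (intro borel_measurable_sum borel_measurable_times) auto
  then have Sx: "?S x \<in> Lp_fun M p" by (rule Lp_fun_cong_AE[OF y(1) _ ae])
  then show "?S x \<in> Lp_fun M p \<and> T (Lp_class M p x) = Lp_class M p (?S x)"
    using y ae by (simp add: Lp_class_eq_iff)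
qed

section \<open>The commutation relation\<close>

theorem corollary3:
  fixes M :: "'a measure"
    and p q :: ennreal
    and lA lB d :: nat
    and GA GB G :: "'a set"
    and a b c e :: "nat \<Rightarrow> 'a \<Rightarrow> real"
    and A B :: "('a \<Rightarrow> real) set \<Rightarrow> ('a \<Rightarrow> real) set"
    and \<delta> :: real
  assumes "sigma_finite_measure M"
    and "1 \<le> p" and "1 \<le> q" and "1 / p + 1 / q = 1"
    and "lA > 0" and "lB > 0"
    and "GA \<in> sets M" and "GB \<in> sets M"
    and "\<And>i. i \<in> {1..lA} \<Longrightarrow> a i \<in> Lp_fun M p"
    and "\<And>j. j \<in> {1..lB} \<Longrightarrow> b j \<in> Lp_fun M p"
    and "\<And>i. i \<in> {1..lA} \<Longrightarrow> c i \<in> Lp_fun (restrict_space M GA) q"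
    and "\<And>j. j \<in> {1..lB} \<Longrightarrow> e j \<in> Lp_fun (restrict_space M GB) q"
    and "A \<in> Lp_space M p \<rightarrow> Lp_space M p"
    and "B \<in> Lp_space M p \<rightarrow> Lp_space M p"
    and "\<And>x y. x \<in> Lp_fun M p \<Longrightarrow> y \<in> A (Lp_class M p x) \<Longrightarrow>
           AE t in M. y t = (LINT s:GA|M. (\<Sum>i=1..lA. a i t * c i s * x s))"
    and "\<And>x y. x \<in> Lp_fun M p \<Longrightarrow> y \<in> B (Lp_class M p x) \<Longrightarrow>
           AE t in M. y t = (LINT s:GB|M. (\<Sum>j=1..lB. b j t * e j s * x s))"
    and "\<exists>u\<in>Lp_space M p. A u \<noteq> Lp_zero M p"
    and "\<exists>u\<in>Lp_space M p. B u \<noteq> Lp_zero M p"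
    and "d > 0"
    and "G = GA \<inter> GB"
  shows "(\<forall>u\<in>Lp_space M p. A (B u) = B (Lp_scale M p \<delta> ((A ^^ d) u))) \<longleftrightarrow>
    (AE (t, s) in M \<Otimes>\<^sub>M M. s \<in> G \<longrightarrow>
       (\<Sum>k=1..lB. \<Sum>m=1..lA. a m t * Q M GA (b k) (c m) * e k s) =
       (\<Sum>k=1..lB. \<Sum>i\<in>{1..d} \<rightarrow>\<^sub>E {1..lA}.
          \<delta> * b k t * Q M GB (e k) (a (i 1)) * gamma_coeff M GA a c i d * c (i d) s)) \<and>
    (AE (t, s) in M \<Otimes>\<^sub>M M. s \<in> GA - G \<longrightarrow>
       (\<Sum>k=1..lB. \<Sum>i\<in>{1..d} \<rightarrow>\<^sub>E {1..lA}.
          \<delta> * b k t * Q M GB (e k) (a (i 1)) * gamma_coeff M GA a c i d * c (i d) s) = 0) \<and>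
    (AE (t, s) in M \<Otimes>\<^sub>M M. s \<in> GB - G \<longrightarrow>
       (\<Sum>k=1..lB. \<Sum>m=1..lA. Q M GA (b k) (c m) * a m t * e k s) = 0)"
proof -
  note pq = assms(2-4)
  let ?cA = "\<lambda>i. zero_ext GA (c i)" and ?eB = "\<lambda>k. zero_ext GB (e k)"
  let ?SA = "fin_rank M {1..lA} a ?cA" and ?SB = "fin_rank M {1..lB} b ?eB"
  let ?P = "{1..d} \<rightarrow>\<^sub>E {1..lA}"
  have cA: "?cA i \<in> Lp_fun M q" if "i \<in> {1..lA}" for i
    using assms(7) assms(11)[OF that] by (rule zero_ext_in_Lp_fun)
  have eB: "?eB k \<in> Lp_fun M q" if "k \<in> {1..lB}" for k
    using assms(8) assms(12)[OF that] by (rule zero_ext_in_Lp_fun)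
  have A: "induces M p A ?SA"
    using pq assms(7) Lp_fun_measurable[OF assms(9)] assms(11,13,15) by (rule induces_fin_rank)
  have B: "induces M p B ?SB"
    using pq assms(8) Lp_fun_measurable[OF assms(10)] assms(12,14,16) by (rule induces_fin_rank)
  have first: "i 1 \<in> {1..lA}" and last: "i d \<in> {1..lA}" if "i \<in> ?P" for i
    using that assms(19) by (auto simp: PiE_iff)
  have finP: "finite ?P" by (intro finite_PiE) auto

  \<comment> \<open>The left factors of the kernels of \<open>A B\<close> and of \<open>\<delta> B A\<^sup>d\<close>.\<close>
  define f where "f k = ?SA (b k)" for k
  define h where "h i = ?SB (\<lambda>t. \<delta> * (gamma_coeff M GA a c i d * a (i 1) t))" for i
  have AB: "?SA (?SB x) = fin_rank M {1..lB} f ?eB x" for x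
    unfolding f_def using pq assms(10) cA by (intro fin_rank_comp Lp_Lq_integrable_mult)
  have pow: "(?SA ^^ d) x = fin_rank M ?P (\<lambda>i t. gamma_coeff M GA a c i d * a (i 1) t) (\<lambda>i. ?cA (i d)) x"
    for x
    using assms(19) pq assms(9) cA by (intro fin_rank_funpow Lp_Lq_integrable_mult)
  have BA: "?SB (\<lambda>t. \<delta> * (?SA ^^ d) x t) = fin_rank M ?P h (\<lambda>i. ?cA (i d)) x" for x
  proof -
    have scaled: "(\<lambda>t. \<delta> * (?SA ^^ d) x t) =
        fin_rank M ?P (\<lambda>i t. \<delta> * (gamma_coeff M GA a c i d * a (i 1) t)) (\<lambda>i. ?cA (i d)) x"
      unfolding pow by (simp add: fin_rank_def[abs_def] sum_distrib_left mult.assoc)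
    have int: "integrable M (\<lambda>s. \<delta> * (gamma_coeff M GA a c i d * a (i 1) s) * ?eB k s)"
      if "i \<in> ?P" "k \<in> {1..lB}" for i k
      using pq Lp_fun_scale[OF Lp_fun_scale[OF assms(9)[OF first[OF that(1)]]]] eB[OF that(2)]
      by (rule Lp_Lq_integrable_mult)
    show ?thesis
      unfolding scaled h_def using int by (intro fin_rank_comp)
  qed

  let ?K = "\<lambda>t s. \<Sum>r\<in>{1..lB} <+> ?P. case_sum f (\<lambda>i t. - h i t) r t * case_sum ?eB (\<lambda>i. ?cA (i d)) r s"
  \<comment> \<open>The sums \<open>L\<close> and \<open>R\<close> use the functions without extension by zero, as in the three conditions.
      The difference kernel \<open>?K\<close> agrees with them only up to the indicators of \<open>GB\<close> and \<open>GA\<close>.\<close>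
  define L where "L t s = (\<Sum>k=1..lB. \<Sum>m=1..lA. a m t * Q M GA (b k) (c m) * e k s)" for t s
  define R where "R t s = (\<Sum>k=1..lB. \<Sum>i\<in>?P.
      \<delta> * b k t * Q M GB (e k) (a (i 1)) * gamma_coeff M GA a c i d * c (i d) s)" for t s
  have K: "?K t s = indicator GB s * L t s - indicator GA s * R t s" for t s
  proof -
    have "(\<Sum>k=1..lB. f k t * ?eB k s) = indicator GB s * L t s"
      by (simp add: f_def fin_rank_def L_def zero_ext_def Q_zero_ext sum_distrib_left sum_distrib_right mult_ac)
    moreover have "(\<Sum>i\<in>?P. h i t * ?cA (i d) s) = indicator GA s * R t s"
    proof -
      have "h i t = (\<Sum>k=1..lB. \<delta> * b k t * Q M GB (e k) (a (i 1)) * gamma_coeff M GA a c i d)" for i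
      proof -
        have pull: "(LINT s|M. \<delta> * (gamma_coeff M GA a c i d * a (i 1) s) * ?eB k s) =
            \<delta> * gamma_coeff M GA a c i d * Q M GB (e k) (a (i 1))" for k
        proof -
          have "Q M GB (e k) (a (i 1)) = (LINT s|M. a (i 1) s * ?eB k s)"
            by (simp add: Q_def set_lebesgue_integral_def zero_ext_def mult_ac)
          then show ?thesis by (simp add: mult.assoc)
        qed
        show ?thesis unfolding h_def fin_rank_def pull by (simp add: mult_ac)
      qed
      then show ?thesis
        unfolding R_def
        by (subst sum.swap) (simp add: zero_ext_def sum_distrib_left sum_distrib_right mult_ac)
    qed
    ultimately show ?thesis
      using finP by (simp add: sum.Plus sum_negf)
  qed

  have "(\<forall>u\<in>Lp_space M p. A (B u) = B (Lp_scale M p \<delta> ((A ^^ d) u))) \<longleftrightarrow>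
      (\<forall>x\<in>Lp_fun M p. A (B (Lp_class M p x)) = B (Lp_scale M p \<delta> ((A ^^ d) (Lp_class M p x))))"
    by (simp add: Lp_space_def)
  also have "\<dots> \<longleftrightarrow> (\<forall>x\<in>Lp_fun M p. AE t in M. ?SA (?SB x) t = ?SB (\<lambda>t. \<delta> * (?SA ^^ d) x t) t)"
  proof (intro ball_cong refl)
    fix x assume x: "x \<in> Lp_fun M p"
    note Bx = inducesD[OF B x] and Ax = inducesD[OF induces_funpow[OF A] x, of d]
    note ABx = inducesD[OF A Bx(1)] and BAx = inducesD[OF B Lp_fun_scale[OF Ax(1)], of \<delta>]
    show "A (B (Lp_class M p x)) = B (Lp_scale M p \<delta> ((A ^^ d) (Lp_class M p x))) \<longleftrightarrow>
      (AE t in M. ?SA (?SB x) t = ?SB (\<lambda>t. \<delta> * (?SA ^^ d) x t) t)"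
      by (simp only: Bx(2) Ax(2) ABx(2) BAx(2) Lp_scale_class[OF Ax(1)] Lp_class_eq_iff[OF ABx(1) BAx(1)])
  qed
  also have "\<dots> \<longleftrightarrow> (\<forall>x\<in>Lp_fun M p. AE t in M. fin_rank M ({1..lB} <+> ?P)
      (case_sum f (\<lambda>i t. - h i t)) (case_sum ?eB (\<lambda>i. ?cA (i d))) x t = 0)"
    unfolding AB BA fin_rank_diff[OF finite_atLeastAtMost finP] by simp
  also have "\<dots> \<longleftrightarrow> (AE (t, s) in M \<Otimes>\<^sub>M M. ?K t s = 0)"
  proof (rule fin_rank_zero_iff_kernel_zero[OF assms(1) pq])
    show "finite ({1..lB} <+> ?P)" using finP by simp
    have "f k \<in> borel_measurable M" for k
      unfolding f_def fin_rank_def[abs_def] using Lp_fun_measurable[OF assms(9)]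
      by (intro borel_measurable_sum borel_measurable_times) auto
    moreover have "h i \<in> borel_measurable M" for i
      unfolding h_def fin_rank_def[abs_def] using Lp_fun_measurable[OF assms(10)]
      by (intro borel_measurable_sum borel_measurable_times) auto
    ultimately show "case_sum f (\<lambda>i t. - h i t) r \<in> borel_measurable M" for r
      by (cases r) auto
    show "case_sum ?eB (\<lambda>i. ?cA (i d)) r \<in> Lp_fun M q" if "r \<in> {1..lB} <+> ?P" for r
      using that cA[OF last] eB by auto
  qed
  also have "\<dots> \<longleftrightarrow> (AE (t, s) in M \<Otimes>\<^sub>M M. (s \<in> G \<longrightarrow> L t s = R t s) \<and>
      (s \<in> GA - G \<longrightarrow> R t s = 0) \<and> (s \<in> GB - G \<longrightarrow> L t s = 0))"
  proof -
    have "?K t s = 0 \<longleftrightarrow> (s \<in> G \<longrightarrow> L t s = R t s) \<and>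
        (s \<in> GA - G \<longrightarrow> R t s = 0) \<and> (s \<in> GB - G \<longrightarrow> L t s = 0)" for t s
      unfolding K assms(20) by (auto simp: indicator_def)
    then show ?thesis by simp
  qed
  finally show ?thesis
    by (simp add: L_def R_def case_prod_unfold AE_conj_iff mult.commute[of "Q M GA _ _"])
qed

end
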